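(* Let $\mathcal X$ be a countable domain and let $A$ be a learning rule that is $n$-sample $\rho$-TV indistinguishable. Then there exists an equivalent learning rule $A'$ that is $n$-sample $\frac{2\rho}{1+\rho}$-replicable.
   Context: An $n$-sample learning rule over a domain $\mathcal X$ is a randomized map $A:(\mathcal X\times\{0,1\})^n\to\{0,1\}^{\mathcal X}$; $A(S)$ denotes the probability distribution of its output on input $S$. $A$ is $n$-sample $\rho$-TV indistinguishable if for every distribution $\mathcal D$ over $\mathcal X\times\{0,1\}$ and independent $S,S'\sim\mathcal D^n$, $\mathbf E_{S,S'}[d_{\mathrm{TV}}(A(S),A(S'))]\le\rho$. Two learning rules $A,A'$ are equivalent if $A(S)=A'(S)$ (as distributions over hypotheses) for every sample $S$. $A'$ is $n$-sample $\rho'$-replicable if there is a probability space $\mathcal R$ (internal randomness) and an implementation $A'(S,r)$, deterministic in $(S,r)$, with $A'(S)$ the law of $A'(S,r)$ for $r\sim\mathcal R$, such that for every distribution $\mathcal D$ over $\mathcal X\times\{0,1\}$, $\Pr_{S,S'\sim\mathcal D^n,\ r\sim\mathcal R}[A'(S,r)\ne A'(S',r)]\le\rho'$, with $S,S',r$ independent. *)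

theory Defs
  imports "HOL-Probability.Probability"
begin

type_synonym 'x sample = "('x \<times> bool) list"
type_synonym 'x hypothesis = "'x \<Rightarrow> bool"

abbreviation hyp_algebra :: "'x hypothesis measure" where
  "hyp_algebra \<equiv> Pi\<^sub>M UNIV (\<lambda>_. count_space UNIV)"

definition tv_dist :: "'a measure \<Rightarrow> 'a measure \<Rightarrow> real" where
  "tv_dist M N = (SUP E\<in>sets M. \<bar>measure M E - measure N E\<bar>)"

text \<open>
  Only samples of length \<open>n\<close> matter: the values of a rule on other lists are unconstrained
  junk, which the definitions below never use.
\<close>

definition learning_rule :: "nat \<Rightarrow> ('x sample \<Rightarrow> 'x hypothesis measure) \<Rightarrow> bool" where
  "learning_rule n A \<longleftrightarrow> (\<forall>S. length S = n \<longrightarrow> A S \<in> space (prob_algebra hyp_algebra))"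

definition equivalent_rules ::
  "nat \<Rightarrow> ('x sample \<Rightarrow> 'x hypothesis measure) \<Rightarrow> ('x sample \<Rightarrow> 'x hypothesis measure) \<Rightarrow> bool" where
  "equivalent_rules n A A' \<longleftrightarrow> (\<forall>S. length S = n \<longrightarrow> A S = A' S)"

text \<open>
  Distributions over the countable set of labelled examples carry the discrete
  sigma-algebra and are therefore given as PMFs; \<open>replicate_pmf n D\<close> is the \<open>n\<close>-fold product.
\<close>

definition tv_indistinguishable ::
  "nat \<Rightarrow> real \<Rightarrow> ('x::countable sample \<Rightarrow> 'x hypothesis measure) \<Rightarrow> bool" where
  "tv_indistinguishable n \<rho> A \<longleftrightarrow>
     (\<forall>D :: ('x \<times> bool) pmf.
        measure_pmf.expectation (pair_pmf (replicate_pmf n D) (replicate_pmf n D))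
          (\<lambda>(S, S'). tv_dist (A S) (A S')) \<le> \<rho>)"

definition implementation ::
  "nat \<Rightarrow> ('x sample \<Rightarrow> 'x hypothesis measure) \<Rightarrow> 'r measure
     \<Rightarrow> ('x sample \<Rightarrow> 'r \<Rightarrow> 'x hypothesis) \<Rightarrow> bool" where
  "implementation n A R f \<longleftrightarrow>
     prob_space R \<and>
     (\<forall>S. length S = n \<longrightarrow> f S \<in> R \<rightarrow>\<^sub>M hyp_algebra \<and> distr R hyp_algebra (f S) = A S)"

text \<open>
  The length conditions hold almost surely; without them the event could fail to be measurable
  because of the unconstrained values of \<open>f\<close> on lists of other lengths.
\<close>

definition disagreement_prob ::
  "nat \<Rightarrow> ('x \<times> bool) pmf \<Rightarrow> 'r measure \<Rightarrow> ('x sample \<Rightarrow> 'r \<Rightarrow> 'x hypothesis) \<Rightarrow> real" where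
  "disagreement_prob n D R f =
     measure (measure_pmf (replicate_pmf n D) \<Otimes>\<^sub>M measure_pmf (replicate_pmf n D) \<Otimes>\<^sub>M R)
       {(S, S', r). length S = n \<and> length S' = n \<and> r \<in> space R \<and> f S r \<noteq> f S' r}"

text \<open>
  HOL cannot quantify existentially over the type underlying the probability space \<open>R\<close>, so it
  is fixed to \<open>nat \<Rightarrow> real\<close>; the sigma-algebra and the measure are arbitrary. For
  countable \<open>'x\<close> this loses nothing: an implementation over any probability space is a random
  element of the countable product, over all samples of length \<open>n\<close>, of copies of
  \<open>'x hypothesis\<close>, and that product embeds measurably into the space of binary sequences.
\<close>

definition replicable ::
  "nat \<Rightarrow> real \<Rightarrow> ('x::countable sample \<Rightarrow> 'x hypothesis measure) \<Rightarrow> bool" where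
  "replicable n \<rho> A \<longleftrightarrow>
     (\<exists>(R :: (nat \<Rightarrow> real) measure) f.
        implementation n A R f \<and>
        (\<forall>D :: ('x \<times> bool) pmf. disagreement_prob n D R f \<le> \<rho>))"

lemma disagreement_event_measurable:
  fixes f :: "'x::countable sample \<Rightarrow> 'r \<Rightarrow> 'x hypothesis"
  assumes "implementation n A R f"
  shows "{(S, S', r). length S = n \<and> length S' = n \<and> r \<in> space R \<and> f S r \<noteq> f S' r}
    \<in> sets (measure_pmf (replicate_pmf n D) \<Otimes>\<^sub>M measure_pmf (replicate_pmf n D) \<Otimes>\<^sub>M R)"
    (is "?E \<in> sets ?M")
proof -
  have E: "?E = (\<Union>S\<in>{S. length S = n}. \<Union>S'\<in>{S. length S = n}. \<Union>x.
      {S} \<times> {S'} \<times> {r \<in> space R. f S r x \<noteq> f S' r x})"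
    by (auto simp: fun_eq_iff)
  have [measurable]: "(\<lambda>r. f S r x) \<in> R \<rightarrow>\<^sub>M count_space UNIV" if "length S = n" for S x
    using assms that measurable_compose[of "f S" R hyp_algebra "\<lambda>h. h x" "count_space UNIV"]
    unfolding implementation_def by (auto intro: measurable_component_singleton)
  have "{S} \<times> {S'} \<times> {r \<in> space R. f S r x \<noteq> f S' r x} \<in> sets ?M"
    if [simp]: "length S = n" "length S' = n" for S S' x
  proof -
    have "{r \<in> space R. f S r x \<noteq> f S' r x} \<in> sets R"
      by measurable
    then show ?thesis by (intro pair_measureI) auto
  qed
  then show ?thesis unfolding E
    by (intro sets.countable_UN') auto
qed

end

theory Submission
  imports Defs
begin

text \<open>
  It suffices to couple all the laws \<open>A S\<close> on one probability space such that the outputs for \<open>S\<close>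
  and \<open>S'\<close> differ with probability at most \<open>2 d / (1 + d)\<close>, where \<open>d\<close> is their total variation
  distance: this bound is concave and increasing in \<open>d\<close>, so Jensen's inequality gives the claim.

  On a finite set \<open>Z\<close>, give each \<open>z\<close> an independent exponential clock \<open>\<omega> z\<close> and let \<open>p\<close> choose the
  point minimising \<open>\<omega> z / p z\<close>. It has law \<open>p\<close>, and two laws \<open>p\<close>, \<open>q\<close> both choose \<open>y\<close> with probability
  at least \<open>min (p y) (q y) / (\<Sum>z. max (p z) (q z))\<close>; summing over \<open>y\<close> gives \<open>(1 - d) / (1 + d)\<close>.

  Hypotheses on a countable domain are handled by truncating to the first \<open>m\<close> points, which does
  not increase \<open>d\<close>, and letting \<open>m\<close> tend to infinity: the joint laws of all truncated outputs live
  on a countable product of two-point spaces, so along a subsequence all cylinder probabilities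
  converge, and the Daniell-Kolmogorov theorem turns the limits into a coupling of the full laws.
\<close>

section \<open>Subsequential limits of measures on bit sequences\<close>

abbreviation bits :: "('i \<Rightarrow> bool) measure" where
  "bits \<equiv> Pi\<^sub>M UNIV (\<lambda>_. count_space UNIV)"

section \<open>Events determined by finitely many coordinates\<close>

definition depends_on :: "'i set \<Rightarrow> (('i \<Rightarrow> bool) \<Rightarrow> bool) \<Rightarrow> bool" where
  "depends_on J F \<longleftrightarrow> (\<forall>b c. (\<forall>j\<in>J. b j = c j) \<longrightarrow> F b = F c)"

lemma depends_onD: "depends_on J F \<Longrightarrow> (\<And>j. j \<in> J \<Longrightarrow> b j = c j) \<Longrightarrow> F b = F c"
  by (auto simp: depends_on_def)

text \<open>A bit pattern on \<open>J\<close> is represented by the total function that is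
  \<open>False\<close> off \<open>J\<close>; such functions correspond to the subsets of
  \<open>J\<close>. This choice of representative makes the cylinders below disjoint and finite in
  number.\<close>

lemma finite_patterns: "finite J \<Longrightarrow> finite {w. \<forall>j. w j \<longrightarrow> j \<in> J}"
proof -
  assume "finite J"
  then have "finite ((\<lambda>A j. j \<in> A) ` Pow J)" by simp
  moreover have "{w. \<forall>j. w j \<longrightarrow> j \<in> J} \<subseteq> (\<lambda>A j. j \<in> A) ` Pow J"
  proof
    fix w assume "w \<in> {w. \<forall>j. w j \<longrightarrow> j \<in> J}"
    then show "w \<in> (\<lambda>A j. j \<in> A) ` Pow J"
      by (intro image_eqI[of _ _ "{j. w j}"]) auto
  qed
  ultimately show ?thesis by (rule finite_subset[rotated])
qed

lemma cylinder_decomposition: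
  assumes "depends_on J F"
  shows "{b. F b} = (\<Union>w\<in>{w. (\<forall>j. w j \<longrightarrow> j \<in> J) \<and> F w}. {b. \<forall>j\<in>J. b j = w j})"
proof (intro equalityI subsetI)
  fix b assume b: "b \<in> {b. F b}"
  have "F (\<lambda>j. j \<in> J \<and> b j) = F b"
    by (rule depends_onD[OF assms]) auto
  with b show "b \<in> (\<Union>w\<in>{w. (\<forall>j. w j \<longrightarrow> j \<in> J) \<and> F w}. {b. \<forall>j\<in>J. b j = w j})"
    by (intro UN_I[of "\<lambda>j. j \<in> J \<and> b j"]) auto
qed (use assms depends_onD in blast)

lemma sets_bits_basic [measurable]:
  assumes "finite J" shows "{b. \<forall>j\<in>J. b j = w j} \<in> sets bits"
proof -
  have "{b \<in> space bits. \<forall>j\<in>J. b j = w j} \<in> sets bits"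
    using assms by measurable
  then show ?thesis by (simp add: space_PiM)
qed

lemma sets_bits_cylinder:
  assumes "finite J" "depends_on J F"
  shows "{b. F b} \<in> sets bits"
  unfolding cylinder_decomposition[OF assms(2)]
  using finite_patterns[OF assms(1)]
  by (intro sets.finite_UN) (auto intro: rev_finite_subset sets_bits_basic[OF assms(1)])

lemma measure_cylinder:
  assumes "finite J" "depends_on J F" "prob_space M" "sets M = sets bits"
  shows "measure M {b. F b} =
    (\<Sum>w\<in>{w. (\<forall>j. w j \<longrightarrow> j \<in> J) \<and> F w}. measure M {b. \<forall>j\<in>J. b j = w j})"
proof -
  interpret prob_space M by fact
  show ?thesis
    unfolding cylinder_decomposition[OF assms(2)]
  proof (rule finite_measure_finite_Union)
    show "finite {w. (\<forall>j. w j \<longrightarrow> j \<in> J) \<and> F w}"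
      using finite_patterns[OF assms(1)] by (rule rev_finite_subset) auto
    show "disjoint_family_on (\<lambda>w. {b. \<forall>j\<in>J. b j = w j}) {w. (\<forall>j. w j \<longrightarrow> j \<in> J) \<and> F w}"
      by (auto simp: disjoint_family_on_def fun_eq_iff)
  qed (use sets_bits_basic[OF assms(1)] assms(4) in auto)
qed

section \<open>Compactness and the limit law\<close>

lemma pointwise_convergent_subseq:
  fixes a :: "nat \<Rightarrow> 'i::countable \<Rightarrow> real"
  assumes "\<And>m i. a m i \<in> {0..1}"
  obtains s l where "strict_mono s" "\<And>i. (\<lambda>k. a (s k) i) \<longlonglongrightarrow> l i"
proof -
  \<comment> \<open>The cube is compact by Tychonoff; as a countable product it is first countable,
    hence also sequentially compact.\<close>
  have "compact (PiE UNIV (\<lambda>_::'i. {0..1::real}))"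
    using compactin_PiE[of "\<lambda>_. euclidean" "UNIV :: 'i set" "\<lambda>_. {0..1::real}"]
    by (simp add: compactin_euclidean_iff euclidean_product_topology)
  then have "seq_compact (PiE UNIV (\<lambda>_::'i. {0..1::real}))"
    by (rule compact_imp_seq_compact)
  moreover have "\<forall>m. a m \<in> PiE UNIV (\<lambda>_::'i. {0..1::real})"
    using assms by auto
  ultimately obtain l s where *: "strict_mono s" "(a \<circ> s) \<longlonglongrightarrow> l"
    unfolding seq_compact_def by blast
  have "(\<lambda>k. a (s k) i) \<longlonglongrightarrow> l i" for i
    using continuous_on_tendsto_compose[of UNIV "\<lambda>x. x i", OF continuous_on_product_coordinates *(2)]
    by (simp add: o_def)
  with *(1) that show thesis by blast
qed

text \<open>There are only countably many basic cylinders, so one subsequence makes all their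
  probabilities converge. The limits remain additive and consistent, and the Daniell-Kolmogorov
  theorem extends them to a measure.\<close>

lemma weakly_convergent_subseq_bits:
  fixes M :: "nat \<Rightarrow> ('i::countable \<Rightarrow> bool) measure"
  assumes M: "\<And>m. prob_space (M m)" "\<And>m. sets (M m) = sets bits"
  obtains s L where "strict_mono s" "prob_space L" "sets L = sets bits"
    "\<And>J F. finite J \<Longrightarrow> depends_on J F \<Longrightarrow>
      (\<lambda>k. measure (M (s k)) {b. F b}) \<longlonglongrightarrow> measure L {b. F b}"
proof -
  \<comment> \<open>Lists of pairs (coordinate, prescribed value) name every basic cylinder by an
    element of a countable type.\<close>
  define a where "a m l = measure (M m) {b. \<forall>(j, v)\<in>set l. b j = v}" for m and l :: "('i \<times> bool) list"
  have "a m l \<in> {0..1}" for m l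
    unfolding a_def using prob_space.prob_le_1[OF M(1)] by simp
  then obtain s q where s: "strict_mono s" and q: "\<And>l. (\<lambda>k. a (s k) l) \<longlonglongrightarrow> q l"
    using pointwise_convergent_subseq by blast
  \<comment> \<open>\<open>lim\<close> is total; the value is meaningful for the finitely determined
    \<open>F\<close>, for which \<open>conv\<close> shows convergence.\<close>
  define \<phi> where "\<phi> F = lim (\<lambda>k. measure (M (s k)) {b. F b})" for F
  have conv0: "convergent (\<lambda>k. measure (M (s k)) {b. \<forall>j\<in>J. b j = w j})" if J: "finite J" for J w
  proof -
    obtain xs where xs: "set xs = J" using finite_list[OF J] by blast
    have "{b. \<forall>j\<in>J. b j = w j} = {b. \<forall>(j, v)\<in>set (map (\<lambda>j. (j, w j)) xs). b j = v}"
      using xs by auto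
    then show ?thesis
      using q[of "map (\<lambda>j. (j, w j)) xs"] unfolding a_def by (auto intro: convergentI)
  qed
  have conv: "(\<lambda>k. measure (M (s k)) {b. F b}) \<longlonglongrightarrow> \<phi> F"
    if "finite J" "depends_on J F" for J F
    unfolding \<phi>_def convergent_LIMSEQ_iff[symmetric] measure_cylinder[OF that M]
    by (intro convergent_sum conv0 that)
  \<comment> \<open>The value 0 off the representative patterns makes \<open>p J\<close> a
    probability mass function on total functions when \<open>J\<close> is finite.\<close>
  define p where "p J w = (if \<forall>j. w j \<longrightarrow> j \<in> J then \<phi> (\<lambda>b. \<forall>j\<in>J. b j = w j) else 0)"
    for J :: "'i set" and w
  have dep: "depends_on J (\<lambda>b. \<forall>j\<in>J. b j = w j)" for J :: "'i set" and w
    by (auto simp: depends_on_def)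
  have p_nonneg: "p J w \<ge> 0" if "finite J" for J w
    using LIMSEQ_le_const[OF conv[OF that dep], of 0] by (auto simp: p_def)
  have \<phi>_sum: "\<phi> F = (\<Sum>w\<in>{w. (\<forall>j. w j \<longrightarrow> j \<in> J) \<and> F w}. p J w)"
    if "finite J" "depends_on J F" for J F
  proof (rule LIMSEQ_unique[OF conv[OF that]])
    show "(\<lambda>k. measure (M (s k)) {b. F b}) \<longlonglongrightarrow> (\<Sum>w\<in>{w. (\<forall>j. w j \<longrightarrow> j \<in> J) \<and> F w}. p J w)"
      unfolding measure_cylinder[OF that M]
      by (intro tendsto_sum) (auto simp: p_def conv[OF that(1) dep])
  qed
  have \<phi>_True: "\<phi> (\<lambda>_. True) = 1"
  proof -
    have "measure (M m) UNIV = 1" for m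
      using prob_space.prob_space[OF M(1)[of m]] sets_eq_imp_space_eq[OF M(2)[of m]]
      by (simp add: space_PiM)
    then show ?thesis by (simp add: \<phi>_def)
  qed
  have p_sum: "(\<integral>\<^sup>+ w. ennreal (p J w) \<partial>count_space UNIV) = 1" if "finite J" for J
  proof -
    have "(\<integral>\<^sup>+ w. ennreal (p J w) \<partial>count_space UNIV) = (\<Sum>w\<in>{w. \<forall>j. w j \<longrightarrow> j \<in> J}. ennreal (p J w))"
      by (rule nn_integral_count_space'[OF finite_patterns[OF that]]) (auto simp: p_def)
    also have "\<dots> = ennreal (\<phi> (\<lambda>_. True))"
      using \<phi>_sum[OF that, of "\<lambda>_. True"] p_nonneg[OF that]
      by (simp add: depends_on_def sum_ennreal)
    finally show ?thesis by (simp add: \<phi>_True)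
  qed
  \<comment> \<open>The extension theorem is applied to real coordinates with Borel sets, so bits
    are written as the reals 0 and 1.\<close>
  define emb :: "'i set \<Rightarrow> ('i \<Rightarrow> bool) \<Rightarrow> ('i \<Rightarrow> real)"
    where "emb J w = (\<lambda>j\<in>J. of_bool (w j))" for J w
  define P where "P J = distr (embed_pmf (p J)) (PiM J (\<lambda>_. borel)) (emb J)" for J
  have emb_meas: "emb J \<in> measurable (measure_pmf D) (PiM J (\<lambda>_. borel))" for J D
    by (auto simp: emb_def space_PiM)
  have prob_P: "prob_space (P J)" for J
    unfolding P_def by (rule prob_space.prob_space_distr[OF prob_space_measure_pmf emb_meas])
  have dep_emb: "depends_on J (\<lambda>b. emb J b \<in> E)" for J E
    by (auto simp: depends_on_def emb_def restrict_def cong: if_cong)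
  have measure_P: "measure (P J) E = \<phi> (\<lambda>b. emb J b \<in> E)"
    if J: "finite J" and E: "E \<in> sets (PiM J (\<lambda>_. borel))" for J E
  proof -
    have pmf: "pmf (embed_pmf (p J)) w = p J w" for w
      by (rule pmf_embed_pmf) (use p_nonneg[OF J] p_sum[OF J] in auto)
    have supp: "set_pmf (embed_pmf (p J)) \<subseteq> {w. \<forall>j. w j \<longrightarrow> j \<in> J}"
      by (auto simp: set_pmf_eq pmf p_def split: if_splits)
    have "measure (P J) E = measure (embed_pmf (p J)) {w. emb J w \<in> E}"
      unfolding P_def using emb_meas E
      by (subst measure_distr) (auto simp: vimage_def)
    also have "\<dots> = measure (embed_pmf (p J)) {w. (\<forall>j. w j \<longrightarrow> j \<in> J) \<and> emb J w \<in> E}"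
      using supp by (intro measure_pmf.finite_measure_eq_AE) (auto simp: AE_measure_pmf_iff)
    also have "\<dots> = (\<Sum>w\<in>{w. (\<forall>j. w j \<longrightarrow> j \<in> J) \<and> emb J w \<in> E}. p J w)"
      by (subst measure_measure_pmf_finite)
        (auto simp: pmf intro: rev_finite_subset[OF finite_patterns[OF J]])
    also have "\<dots> = \<phi> (\<lambda>b. emb J b \<in> E)"
      by (rule \<phi>_sum[OF J dep_emb, symmetric])
    finally show ?thesis .
  qed
  interpret PL: polish_projective UNIV P
  proof (intro polish_projective.intro projective_family.intro)
    fix J show "prob_space (P J)" by (rule prob_P)
  next
    \<comment> \<open>Consistency: restricting \<open>emb H b\<close> to \<open>J\<close> gives
      \<open>emb J b\<close>, so both sides are \<open>\<phi>\<close> of the same event about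
      \<open>b\<close>.\<close>
    show "P J = distr (P H) (PiM J (\<lambda>_. borel)) (\<lambda>f. restrict f J)"
      if "J \<subseteq> H" "finite H" for J H
    proof (rule measure_eqI)
      have sets_PH: "sets (P H) = sets (PiM H (\<lambda>_. borel))" by (simp add: P_def)
      have r: "(\<lambda>f. restrict f J) \<in> measurable (P H) (PiM J (\<lambda>_. borel))"
        unfolding measurable_cong_sets[OF sets_PH refl]
        by (rule measurable_restrict_subset) fact
      fix E assume "E \<in> sets (P J)"
      then have E: "E \<in> sets (PiM J (\<lambda>_. borel))" by (simp add: P_def)
      interpret J: prob_space "P J" by (rule prob_P)
      interpret H: prob_space "P H" by (rule prob_P)
      have fin: "finite J" using that finite_subset by blast
      have "measure (P H) ((\<lambda>f. restrict f J) -` E \<inter> space (P H))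
        = \<phi> (\<lambda>b. emb H b \<in> (\<lambda>f. restrict f J) -` E \<inter> space (P H))"
        using measurable_sets[OF r E] by (intro measure_P that) (simp add: sets_PH)
      also have "(\<lambda>b. emb H b \<in> (\<lambda>f. restrict f J) -` E \<inter> space (P H)) = (\<lambda>b. emb J b \<in> E)"
      proof
        fix b
        have "restrict (emb H b) J = emb J b"
          using that(1) by (auto simp: emb_def restrict_def fun_eq_iff)
        then show "(emb H b \<in> (\<lambda>f. restrict f J) -` E \<inter> space (P H)) = (emb J b \<in> E)"
          by (auto simp: P_def space_PiM emb_def)
      qed
      also have "\<phi> \<dots> = measure (P J) E" by (rule measure_P[OF fin E, symmetric])
      finally show "emeasure (P J) E = emeasure (distr (P H) (PiM J (\<lambda>_. borel)) (\<lambda>f. restrict f J)) E"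
        by (simp only: emeasure_distr[OF r E] J.emeasure_eq_measure H.emeasure_eq_measure)
    qed (simp add: P_def)
  qed
  \<comment> \<open>Decodes reals to bits; every value other than 1 is read as \<open>False\<close>,
    so no support statement about the limit is needed.\<close>
  define T :: "('i \<Rightarrow> real) \<Rightarrow> 'i \<Rightarrow> bool" where "T r = (\<lambda>i. r i = 1)" for r
  have T: "T \<in> measurable PL.lim bits"
    unfolding T_def measurable_cong_sets[OF PL.sets_lim refl]
    by (intro measurable_PiM_single') (auto simp: space_PiM)
  define L where "L = distr PL.lim bits T"
  have "measure L {b. F b} = \<phi> F" if J: "finite J" and F: "depends_on J F" for J F
  proof -
    \<comment> \<open>Forcing the argument of \<open>F\<close> to \<open>False\<close> off
      \<open>J\<close> turns the event into one about the \<open>J\<close> coordinates only. As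
      \<open>F\<close> ignores the others, embedding \<open>X\<close> gives back the preimage of
      \<open>F\<close> under \<open>T\<close>.\<close>
    define X where "X = {r \<in> space (PiM J (\<lambda>_. borel)). F (\<lambda>i. i \<in> J \<and> r i = (1::real))}"
    have "(\<lambda>r i. i \<in> J \<and> r i = (1::real)) \<in> measurable (PiM J (\<lambda>_. borel)) bits"
    proof (intro measurable_PiM_single')
      show "(\<lambda>r. i \<in> J \<and> r i = (1::real)) \<in> measurable (PiM J (\<lambda>_. borel)) (count_space UNIV)" for i
        by (cases "i \<in> J") auto
    qed auto
    from measurable_sets[OF this sets_bits_cylinder[OF J F]]
    have X: "X \<in> sets (PiM J (\<lambda>_. borel))"
      unfolding X_def by (simp add: vimage_def Int_def conj_commute)
    have Fres: "F (\<lambda>i. i \<in> J \<and> b i) = F b" for b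
      by (rule depends_onD[OF F]) auto
    have "measure L {b. F b} = measure PL.lim (T -` {b. F b} \<inter> space PL.lim)"
      unfolding L_def by (rule measure_distr[OF T sets_bits_cylinder[OF J F]])
    also have "T -` {b. F b} \<inter> space PL.lim = prod_emb UNIV (\<lambda>_. borel) J X"
    proof -
      have "restrict r J \<in> X \<longleftrightarrow> F (T r)" for r
        unfolding Fres[of "T r", symmetric] by (simp add: X_def T_def space_PiM cong: conj_cong)
      then show ?thesis by (simp add: prod_emb_def space_PiM vimage_def)
    qed
    also have "measure PL.lim \<dots> = measure (P J) X"
      by (rule PL.measure_lim_emb) (use J X in auto)
    also have "\<dots> = \<phi> (\<lambda>b. emb J b \<in> X)" by (rule measure_P[OF J X])
    also have "(\<lambda>b. emb J b \<in> X) = F"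
    proof
      fix b show "(emb J b \<in> X) = F b"
        unfolding Fres[of b, symmetric] by (simp add: X_def emb_def space_PiM cong: conj_cong)
    qed
    finally show ?thesis .
  qed
  moreover have "prob_space L"
    unfolding L_def by (rule PL.P.prob_space_distr[OF T])
  ultimately show thesis
    using s conv by (intro that[of s L]) (auto simp: L_def)
qed

section \<open>Races of exponential clocks\<close>

abbreviation exp_clock :: "real measure" where
  "exp_clock \<equiv> density lborel (exponential_density 1)"

abbreviation clocks :: "'a set \<Rightarrow> ('a \<Rightarrow> real) measure" where
  "clocks Z \<equiv> PiM Z (\<lambda>_. exp_clock)"

lemma prob_space_exp_clock: "prob_space exp_clock"
  by (rule prob_space_exponential_density) simp

lemma prob_space_clocks: "prob_space (clocks Z)"
  by (rule prob_space_PiM) (rule prob_space_exp_clock)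

lemma exp_clock_tail:
  assumes "t \<ge> 0"
  shows "emeasure exp_clock {t<..} = ennreal (exp (- t))"
proof -
  interpret prob_space exp_clock by (rule prob_space_exp_clock)
  have "{t<..} = space exp_clock - {..t}" by auto
  then have "prob {t<..} = 1 - prob {..t}"
    by (metis prob_compl atMost_borel sets_density sets_lborel)
  moreover have "prob {..t} = 1 - exp (- t)"
    using emeasure_erlang_density[of 1 0 t] assms
    by (simp add: measure_def erlang_CDF_def)
  ultimately show ?thesis by (simp add: emeasure_eq_measure)
qed

text \<open>Condition on clock \<open>y\<close> showing \<open>t\<close>: the other clocks exceed
  \<open>c z * t\<close> independently, with total probability \<open>exp (- C * t)\<close> for
  \<open>C\<close> the sum of the \<open>c z\<close>. Integrating this against the density
  \<open>exp (- t)\<close> gives \<open>1 / (1 + C)\<close>.\<close>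

lemma exponential_race:
  assumes Z: "finite Z" "y \<notin> Z" and c: "\<And>z. z \<in> Z \<Longrightarrow> c z \<ge> 0"
  shows "emeasure (clocks (insert y Z))
      {\<omega> \<in> space (clocks (insert y Z)). \<omega> y \<ge> 0 \<and> (\<forall>z\<in>Z. c z * \<omega> y < \<omega> z)}
    = ennreal (1 / (1 + (\<Sum>z\<in>Z. c z)))" (is "emeasure ?M ?E = _")
proof -
  interpret clock: prob_space exp_clock by (rule prob_space_exp_clock)
  interpret product_sigma_finite "\<lambda>_. exp_clock"
    by unfold_locales
  define C where "C = (\<Sum>z\<in>Z. c z)"
  have C: "C \<ge> 0" unfolding C_def by (intro sum_nonneg c)
  have E [measurable]: "?E \<in> sets ?M"
    using Z(1) by measurable
  have "emeasure ?M ?E = (\<integral>\<^sup>+ \<omega>. indicator ?E \<omega> \<partial>?M)"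
    by simp
  also have "\<dots> = (\<integral>\<^sup>+ t. (\<integral>\<^sup>+ \<omega>. indicator ?E (fun_upd \<omega> y t) \<partial>clocks Z) \<partial>exp_clock)"
    by (rule product_nn_integral_insert_rev) (use Z in auto)
  also have "\<dots> = (\<integral>\<^sup>+ t. ennreal (indicator {0..} t * exp (- C * t)) \<partial>exp_clock)"
  proof (rule nn_integral_cong)
    fix t :: real
    have "(\<integral>\<^sup>+ \<omega>. indicator ?E (fun_upd \<omega> y t) \<partial>clocks Z) =
      (\<integral>\<^sup>+ \<omega>. indicator {0..} t * indicator (PiE Z (\<lambda>z. {c z * t<..})) \<omega> \<partial>clocks Z)"
      using Z(2)
      by (intro nn_integral_cong)
        (auto simp: indicator_def space_PiM PiE_def extensional_def Pi_def)
    also have "\<dots> = indicator {0..} t * emeasure (clocks Z) (PiE Z (\<lambda>z. {c z * t<..}))"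
      using Z(1) by (subst nn_integral_cmult) (auto intro!: sets_PiM_I_finite)
    also have "emeasure (clocks Z) (PiE Z (\<lambda>z. {c z * t<..})) = (\<Prod>z\<in>Z. emeasure exp_clock {c z * t<..})"
      using Z(1) by (intro emeasure_PiM) auto
    also have "indicator {0..} t * \<dots> = ennreal (indicator {0..} t * exp (- C * t))"
    proof (cases "t \<ge> 0")
      case True
      then have "(\<Prod>z\<in>Z. emeasure exp_clock {c z * t<..}) = (\<Prod>z\<in>Z. ennreal (exp (- (c z * t))))"
        using c by (intro prod.cong refl exp_clock_tail) auto
      also have "\<dots> = ennreal (exp (- C * t))"
        using Z(1) by (simp add: prod_ennreal C_def exp_sum[symmetric] sum_distrib_right sum_negf)
      finally show ?thesis using True by simp
    qed simp
    finally show "(\<integral>\<^sup>+ \<omega>. indicator ?E (fun_upd \<omega> y t) \<partial>clocks Z) =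
      ennreal (indicator {0..} t * exp (- C * t))" .
  qed
  \<comment> \<open>The integrand is \<open>1 / (1 + C)\<close> times the exponential density of
    rate \<open>1 + C\<close>, whose total mass is 1.\<close>
  also have "\<dots> = (\<integral>\<^sup>+ t. ennreal (1 / (1 + C)) * ennreal (exponential_density (1 + C) t) \<partial>lborel)"
  proof (subst nn_integral_density)
    have "exponential_density 1 t * (indicator {0..} t * exp (- C * t))
        = 1 / (1 + C) * exponential_density (1 + C) t" for t
    proof (cases "t < 0")
      case False
      have "exp (- t) * exp (- C * t) = exp (- t * (1 + C))"
        by (simp add: exp_add[symmetric] algebra_simps)
      with False C show ?thesis by (simp add: exponential_density_def)
    qed (simp add: exponential_density_def)
    then show "(\<integral>\<^sup>+ t. ennreal (exponential_density 1 t) * ennreal (indicator {0..} t * exp (- C * t)) \<partial>lborel)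
      = (\<integral>\<^sup>+ t. ennreal (1 / (1 + C)) * ennreal (exponential_density (1 + C) t) \<partial>lborel)"
      using C by (simp add: ennreal_mult[symmetric])
  qed auto
  also have "\<dots> = ennreal (1 / (1 + C)) * emeasure (density lborel (exponential_density (1 + C))) UNIV"
    by (subst nn_integral_cmult) (auto simp: emeasure_density)
  also have "emeasure (density lborel (exponential_density (1 + C))) UNIV = 1"
    using prob_space.emeasure_space_1[OF prob_space_exponential_density[of "1 + C"]] C by simp
  finally show ?thesis by (simp add: C_def)
qed

text \<open>
  The condition \<open>\<omega> y / p y < \<omega> z / p z\<close> is multiplied out, so that outcomes of probability zero
  never win on nonnegative clocks. When no outcome wins strictly, a null event, \<open>winner\<close> is junk.
\<close>

definition wins :: "'a set \<Rightarrow> ('a \<Rightarrow> real) \<Rightarrow> ('a \<Rightarrow> real) \<Rightarrow> 'a \<Rightarrow> bool" where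
  "wins Z p \<omega> y \<longleftrightarrow> y \<in> Z \<and> (\<forall>z\<in>Z - {y}. \<omega> y * p z < \<omega> z * p y)"

definition winner :: "'a set \<Rightarrow> ('a \<Rightarrow> real) \<Rightarrow> ('a \<Rightarrow> real) \<Rightarrow> 'a" where
  "winner Z p \<omega> = (THE y. wins Z p \<omega> y)"

lemma wins_unique: "wins Z p \<omega> y \<Longrightarrow> wins Z p \<omega> z \<Longrightarrow> y = z"
  unfolding wins_def by (metis DiffI less_asym singletonD)

lemma winner_eq: "wins Z p \<omega> y \<Longrightarrow> winner Z p \<omega> = y"
  unfolding winner_def using wins_unique by (metis the_equality)

lemma measurable_winner [measurable]:
  assumes "finite Z"
  shows "winner Z p \<in> measurable (clocks Z) (count_space UNIV)"
  unfolding winner_def[abs_def]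
proof (rule measurable_THE)
  show "Measurable.pred (clocks Z) (\<lambda>\<omega>. wins Z p \<omega> y)" for y
  proof (cases "y \<in> Z")
    case True
    have comp: "(\<lambda>\<omega>. \<omega> z) \<in> borel_measurable (clocks Z)" if "z \<in> Z" for z
      using measurable_component_singleton[OF that, of "\<lambda>_. exp_clock"] by simp
    have "Measurable.pred (clocks Z) (\<lambda>\<omega>. \<forall>z\<in>Z - {y}. \<omega> y * p z < \<omega> z * p y)"
      using assms True
      by (intro pred_intros_finite borel_measurable_pred_less borel_measurable_times comp) auto
    with True show ?thesis by (simp add: wins_def)
  qed (simp add: wins_def)
  show "countable Z" using assms by (rule countable_finite)
  show "y \<in> Z" if "wins Z p \<omega> y" for \<omega> y
    using that by (simp add: wins_def)
qed (rule wins_unique)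

text \<open>Without a strict winner the description collapses to the single value
  \<open>THE y. False\<close>. So \<open>winner\<close> has finite range, and agreement of two
  winners is a finite union of measurable events.\<close>

lemma winner_cases: "winner Z p \<omega> \<in> insert (THE y. False) Z"
proof (cases "\<exists>y. wins Z p \<omega> y")
  case True
  then show ?thesis using winner_eq wins_def by fastforce
next
  case False
  then show ?thesis by (simp add: winner_def)
qed

lemma sets_winner_eq:
  assumes "finite Z"
  shows "{\<omega> \<in> space (clocks Z). winner Z p \<omega> = y} \<in> sets (clocks Z)"
  using measurable_sets[OF measurable_winner[OF assms], of "{y}" p]
  by (simp add: vimage_def Int_def conj_commute)

lemma sets_winners_eq:
  assumes "finite Z"
  shows "{\<omega> \<in> space (clocks Z). winner Z p \<omega> = y \<and> winner Z q \<omega> = y} \<in> sets (clocks Z)"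
    and "{\<omega> \<in> space (clocks Z). winner Z p \<omega> = winner Z q \<omega>} \<in> sets (clocks Z)"
proof -
  show *: "{\<omega> \<in> space (clocks Z). winner Z p \<omega> = y \<and> winner Z q \<omega> = y} \<in> sets (clocks Z)" for y
    by (rule sets.sets_Collect_conj[OF sets_winner_eq[OF assms] sets_winner_eq[OF assms]])
  have "{\<omega> \<in> space (clocks Z). winner Z p \<omega> = winner Z q \<omega>} =
    (\<Union>y\<in>insert (THE y. False) Z. {\<omega> \<in> space (clocks Z). winner Z p \<omega> = y \<and> winner Z q \<omega> = y})"
    
  proof (intro equalityI subsetI)
    fix \<omega> assume "\<omega> \<in> {\<omega> \<in> space (clocks Z). winner Z p \<omega> = winner Z q \<omega>}"
    then show "\<omega> \<in> (\<Union>y\<in>insert (THE y. False) Z.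
      {\<omega> \<in> space (clocks Z). winner Z p \<omega> = y \<and> winner Z q \<omega> = y})"
      by (intro UN_I[OF winner_cases[of Z p \<omega>]]) simp
  qed auto
  then show "{\<omega> \<in> space (clocks Z). winner Z p \<omega> = winner Z q \<omega>} \<in> sets (clocks Z)"
    using assms * by (simp only:) (intro sets.finite_UN, auto)
qed

lemma common_winner_prob:
  assumes Z: "finite Z" and pq: "\<And>z. z \<in> Z \<Longrightarrow> p z \<ge> 0" "\<And>z. z \<in> Z \<Longrightarrow> q z \<ge> 0" and y: "y \<in> Z"
  shows "min (p y) (q y) / (\<Sum>z\<in>Z. max (p z) (q z)) \<le>
    measure (clocks Z) {\<omega> \<in> space (clocks Z). winner Z p \<omega> = y \<and> winner Z q \<omega> = y}"
proof (cases "min (p y) (q y) > 0")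
  case True
  interpret prob_space "clocks Z" by (rule prob_space_clocks)
  define m where "m = min (p y) (q y)"
  have m: "m > 0" "m \<le> p y" "m \<le> q y" using True by (auto simp: m_def)
  txt \<open>
    Clock \<open>y\<close> winning against the rates \<open>c\<close> forces both races to be won by \<open>y\<close>, because \<open>c z\<close>
    dominates \<open>p z / p y\<close> and \<open>q z / q y\<close>.
  \<close>
  define c where "c z = max (p z) (q z) / m" for z
  have c: "z \<in> Z \<Longrightarrow> c z \<ge> 0" for z using pq m by (auto simp: c_def le_max_iff_disj)
  have Zy: "insert y (Z - {y}) = Z" using y by auto
  let ?E = "{\<omega> \<in> space (clocks Z). \<omega> y \<ge> 0 \<and> (\<forall>z\<in>Z - {y}. c z * \<omega> y < \<omega> z)}"
  have sub: "?E \<subseteq> {\<omega> \<in> space (clocks Z). winner Z p \<omega> = y \<and> winner Z q \<omega> = y}"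
  proof safe
    fix \<omega> assume *: "0 \<le> \<omega> y" "\<forall>z\<in>Z - {y}. c z * \<omega> y < \<omega> z"
    \<comment> \<open>Stated for general weights \<open>r\<close> to serve both \<open>p\<close> and
      \<open>q\<close>. Positivity of \<open>\<omega> z\<close> is what allows \<open>m\<close> to
      be replaced by the larger \<open>r y\<close>.\<close>
    have "wins Z r \<omega> y" if r: "\<And>z. z \<in> Z \<Longrightarrow> r z \<le> max (p z) (q z)" "m \<le> r y" for r
      unfolding wins_def
    proof (intro conjI y ballI)
      fix z assume z: "z \<in> Z - {y}"
      have "0 \<le> c z * \<omega> y" using c z *(1) by auto
      then have pos: "0 < \<omega> z" using *(2) z by (meson le_less_trans)
      have "\<omega> y * r z \<le> \<omega> y * max (p z) (q z)"
        using r z *(1) by (intro mult_left_mono) auto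
      also have "\<dots> = m * (c z * \<omega> y)" using m by (simp add: c_def)
      also have "\<dots> < m * \<omega> z" using m * z by auto
      also have "\<dots> \<le> \<omega> z * r y" using r(2) pos by (simp add: mult.commute)
      finally show "\<omega> y * r z < \<omega> z * r y" .
    qed
    then show "winner Z p \<omega> = y" "winner Z q \<omega> = y"
      using m by (auto intro!: winner_eq)
  qed
  have "(\<Sum>z\<in>Z. max (p z) (q z)) / m = (\<Sum>z\<in>Z. c z)"
    by (simp add: c_def sum_divide_distrib)
  also have "\<dots> = c y + (\<Sum>z\<in>Z - {y}. c z)"
    by (rule sum.remove[OF Z y])
  \<comment> \<open>The term \<open>c y\<close> is at least 1, since the maximum at \<open>y\<close>
    is at least \<open>m\<close>; so it may stand in for the 1 of the race formula.\<close>
  finally have "1 + (\<Sum>z\<in>Z - {y}. c z) \<le> (\<Sum>z\<in>Z. max (p z) (q z)) / m"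
    using m by (simp add: c_def le_max_iff_disj)
  moreover have "(\<Sum>z\<in>Z - {y}. c z) \<ge> 0" using c by (intro sum_nonneg) auto
  ultimately have "1 / ((\<Sum>z\<in>Z. max (p z) (q z)) / m) \<le> 1 / (1 + (\<Sum>z\<in>Z - {y}. c z))"
    by (intro divide_left_mono mult_pos_pos) linarith+
  also have "\<dots> = prob ?E"
    using exponential_race[of "Z - {y}" y c] Z c \<open>(\<Sum>z\<in>Z - {y}. c z) \<ge> 0\<close>
    unfolding Zy by (simp add: measure_def)
  also have "\<dots> \<le> prob {\<omega> \<in> space (clocks Z). winner Z p \<omega> = y \<and> winner Z q \<omega> = y}"
    by (intro finite_measure_mono sub sets_winners_eq Z)
  finally show ?thesis by (simp add: m_def)
next
  case False
  then have "min (p y) (q y) = 0" using pq y by (auto simp: min_def not_less intro: antisym)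
  then show ?thesis by simp
qed

text \<open>Taking \<open>q = p\<close> in the previous bound gives at least \<open>p y\<close> for
  each \<open>y\<close>. The events are disjoint and the \<open>p y\<close> already sum to 1, so
  every inequality is an equality.\<close>

lemma winner_prob:
  assumes Z: "finite Z" and p: "\<And>z. z \<in> Z \<Longrightarrow> p z \<ge> 0" "(\<Sum>z\<in>Z. p z) = 1" and y: "y \<in> Z"
  shows "measure (clocks Z) {\<omega> \<in> space (clocks Z). winner Z p \<omega> = y} = p y"
proof -
  interpret prob_space "clocks Z" by (rule prob_space_clocks)
  let ?P = "\<lambda>z. prob {\<omega> \<in> space (clocks Z). winner Z p \<omega> = z}"
  note [simp] = sets_winner_eq[OF Z]
  have le: "p z \<le> ?P z" if "z \<in> Z" for z
    using common_winner_prob[of Z p p, OF Z p(1) p(1) that] p(2) by simp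
  have "(\<Sum>z\<in>Z. ?P z) = prob (\<Union>z\<in>Z. {\<omega> \<in> space (clocks Z). winner Z p \<omega> = z})"
    using Z by (intro finite_measure_finite_Union[symmetric]) (auto simp: disjoint_family_on_def)
  also have "\<dots> \<le> 1" by (rule prob_le_1)
  finally have "(\<Sum>z\<in>Z. p z) = (\<Sum>z\<in>Z. ?P z)"
    using sum_mono[of Z p ?P] le p(2) by auto
  from sum_mono_inv[OF this le y Z] show ?thesis by simp
qed

text \<open>Here \<open>d\<close> is the total excess of \<open>p\<close> over \<open>q\<close>. The
  maxima are \<open>q\<close> plus the excess and sum to \<open>1 + d\<close>; the minima are
  \<open>p\<close> minus the excess and sum to \<open>1 - d\<close>. The rest is the complement of
  agreement.\<close>

lemma winners_differ_prob:
  assumes Z: "finite Z"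
    and p: "\<And>z. z \<in> Z \<Longrightarrow> p z \<ge> 0" "(\<Sum>z\<in>Z. p z) = 1"
    and q: "\<And>z. z \<in> Z \<Longrightarrow> q z \<ge> 0" "(\<Sum>z\<in>Z. q z) = 1"
    and d: "(\<Sum>z\<in>Z. max 0 (p z - q z)) = d"
  shows "measure (clocks Z) {\<omega> \<in> space (clocks Z). winner Z p \<omega> \<noteq> winner Z q \<omega>}
    \<le> 2 * d / (1 + d)"
proof -
  interpret prob_space "clocks Z" by (rule prob_space_clocks)
  note [simp] = sets_winners_eq[OF Z]
  have "d \<ge> 0" unfolding d[symmetric] by (intro sum_nonneg) auto
  have "(\<Sum>z\<in>Z. max (p z) (q z)) = (\<Sum>z\<in>Z. q z + max 0 (p z - q z))"
    by (intro sum.cong) auto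
  then have max: "(\<Sum>z\<in>Z. max (p z) (q z)) = 1 + d" by (simp add: sum.distrib d q)
  have "(\<Sum>z\<in>Z. min (p z) (q z)) = (\<Sum>z\<in>Z. p z - max 0 (p z - q z))"
    by (intro sum.cong) auto
  then have min: "(\<Sum>z\<in>Z. min (p z) (q z)) = 1 - d" by (simp add: sum_subtractf d p)
  let ?A = "\<lambda>y. {\<omega> \<in> space (clocks Z). winner Z p \<omega> = y \<and> winner Z q \<omega> = y}"
  have "(1 - d) / (1 + d) = (\<Sum>y\<in>Z. min (p y) (q y) / (\<Sum>z\<in>Z. max (p z) (q z)))"
    by (simp add: max min sum_divide_distrib[symmetric])
  also have "\<dots> \<le> (\<Sum>y\<in>Z. prob (?A y))"
    using Z p q by (intro sum_mono common_winner_prob) auto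
  also have "\<dots> = prob (\<Union>y\<in>Z. ?A y)"
    using Z by (intro finite_measure_finite_Union[symmetric]) (auto simp: disjoint_family_on_def)
  also have "\<dots> \<le> prob {\<omega> \<in> space (clocks Z). winner Z p \<omega> = winner Z q \<omega>}"
    by (intro finite_measure_mono) auto
  also have "{\<omega> \<in> space (clocks Z). winner Z p \<omega> = winner Z q \<omega>} =
      space (clocks Z) - {\<omega> \<in> space (clocks Z). winner Z p \<omega> \<noteq> winner Z q \<omega>}"
    by auto
  also have "prob \<dots> = 1 - prob {\<omega> \<in> space (clocks Z). winner Z p \<omega> \<noteq> winner Z q \<omega>}"
    by (intro prob_compl sets.sets_Collect_neg) (simp add: sets_winners_eq[OF Z])
  finally show ?thesis using \<open>d \<ge> 0\<close> by (simp add: field_simps)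
qed

section \<open>Coupling countably many laws of hypotheses\<close>

definition trunc :: "nat \<Rightarrow> ('x::countable \<Rightarrow> bool) \<Rightarrow> 'x \<Rightarrow> bool" where
  "trunc m h = (\<lambda>x. to_nat x < m \<and> h x)"

definition trunc_range :: "nat \<Rightarrow> ('x::countable \<Rightarrow> bool) set" where
  "trunc_range m = {w. \<forall>x. w x \<longrightarrow> to_nat x < m}"

definition cell_prob :: "nat \<Rightarrow> ('x::countable \<Rightarrow> bool) measure \<Rightarrow> ('x \<Rightarrow> bool) \<Rightarrow> real" where
  "cell_prob m P z = measure P {h. trunc m h = z}"

lemma finite_to_nat_less: "finite {x::'x::countable. to_nat x < m}"
  using finite_vimageI[OF finite_lessThan[of m] inj_to_nat] by (simp add: vimage_def)

lemma finite_trunc_range: "finite (trunc_range m)"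
  using finite_patterns[OF finite_to_nat_less[of m]] by (simp add: trunc_range_def)

lemma trunc_in_range: "trunc m h \<in> trunc_range m"
  by (simp add: trunc_def trunc_range_def)

lemma sets_trunc:
  "{h :: 'x::countable \<Rightarrow> bool. trunc m h \<in> T} \<in> sets bits"
proof (rule sets_bits_cylinder)
  show "finite {x::'x. to_nat x < m}" by (rule finite_to_nat_less)
  show "depends_on {x::'x. to_nat x < m} (\<lambda>h. trunc m h \<in> T)"
    unfolding depends_on_def
  proof (intro allI impI)
    fix b c :: "'x \<Rightarrow> bool" assume "\<forall>x\<in>{x. to_nat x < m}. b x = c x"
    then have "trunc m b = trunc m c" by (auto simp: trunc_def)
    then show "(trunc m b \<in> T) = (trunc m c \<in> T)" by simp
  qed
qed

lemma sum_cell_prob: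
  fixes P :: "('x::countable \<Rightarrow> bool) measure"
  assumes "prob_space P" "sets P = sets bits"
  shows "(\<Sum>z\<in>trunc_range m \<inter> T. cell_prob m P z) = measure P {h. trunc m h \<in> T}"
proof -
  interpret prob_space P by fact
  have cells: "{h. trunc m h = z} \<in> sets P" for z
    using sets_trunc[of m "{z}"] assms(2) by simp
  have "(\<Sum>z\<in>trunc_range m \<inter> T. cell_prob m P z) = prob (\<Union>z\<in>trunc_range m \<inter> T. {h. trunc m h = z})"
    unfolding cell_prob_def using cells
    by (intro finite_measure_finite_Union[symmetric])
      (auto simp: disjoint_family_on_def finite_trunc_range)
  also have "(\<Union>z\<in>trunc_range m \<inter> T. {h. trunc m h = z}) = {h. trunc m h \<in> T}"
    using trunc_in_range by auto
  finally show ?thesis .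
qed

lemma sum_cell_prob_UNIV:
  assumes "prob_space P" "sets P = sets bits"
  shows "(\<Sum>z\<in>trunc_range m. cell_prob m P z) = 1"
  using sum_cell_prob[OF assms, of m UNIV] prob_space.prob_space[OF assms(1)]
    sets_eq_imp_space_eq[OF assms(2)] by (simp add: space_PiM)

lemma cell_prob_nonneg: "cell_prob m P z \<ge> 0"
  by (simp add: cell_prob_def)

section \<open>Total variation distance and truncated laws\<close>

lemma tv_dist_bdd_above:
  assumes "prob_space P" "prob_space Q"
  shows "bdd_above ((\<lambda>E. \<bar>measure P E - measure Q E\<bar>) ` sets P)"
proof (rule bdd_aboveI2)
  fix E
  show "\<bar>measure P E - measure Q E\<bar> \<le> 1"
    using assms[THEN prob_space.prob_le_1, of E] measure_nonneg[of P E] measure_nonneg[of Q E]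
    by linarith
qed

lemma tv_dist_upper:
  assumes "prob_space P" "prob_space Q" "E \<in> sets P"
  shows "\<bar>measure P E - measure Q E\<bar> \<le> tv_dist P Q"
  unfolding tv_dist_def by (rule cSUP_upper[OF assms(3) tv_dist_bdd_above[OF assms(1,2)]])

lemma tv_dist_nonneg: "prob_space P \<Longrightarrow> prob_space Q \<Longrightarrow> tv_dist P Q \<ge> 0"
  using tv_dist_upper[of P Q "{}"] by auto

lemma tv_dist_le_1:
  assumes "prob_space P" "prob_space Q"
  shows "tv_dist P Q \<le> 1"
  unfolding tv_dist_def
proof (rule cSUP_least)
  fix E
  show "\<bar>measure P E - measure Q E\<bar> \<le> 1"
    using assms[THEN prob_space.prob_le_1, of E] measure_nonneg[of P E] measure_nonneg[of Q E]
    by linarith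
qed auto

text \<open>The excess is attained on a single event, the union of the cells that \<open>P\<close>
  weighs more than \<open>Q\<close>, and this event competes in the supremum.\<close>

lemma cell_excess_le_tv_dist:
  assumes P: "prob_space P" "sets P = sets bits" and Q: "prob_space Q" "sets Q = sets bits"
  shows "(\<Sum>z\<in>trunc_range m. max 0 (cell_prob m P z - cell_prob m Q z)) \<le> tv_dist P Q"
proof -
  define T where "T = {z. cell_prob m P z > cell_prob m Q z}"
  have "(\<Sum>z\<in>trunc_range m. max 0 (cell_prob m P z - cell_prob m Q z))
    = (\<Sum>z\<in>trunc_range m \<inter> T. cell_prob m P z - cell_prob m Q z)"
    using finite_trunc_range by (subst sum.inter_restrict) (auto intro!: sum.cong simp: T_def)
  also have "\<dots> = measure P {h. trunc m h \<in> T} - measure Q {h. trunc m h \<in> T}"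
    by (simp add: sum_subtractf sum_cell_prob[OF P] sum_cell_prob[OF Q])
  also have "\<dots> \<le> tv_dist P Q"
    using tv_dist_upper[OF P(1) Q(1), of "{h. trunc m h \<in> T}"] sets_trunc[of m T] P(2) by simp
  finally show ?thesis .
qed

text \<open>The masses on \<open>Z\<close> already sum to 1, so values outside \<open>Z\<close>,
  including the junk value, occur only on a null event and \<open>T\<close> may be cut down to
  \<open>Z \<inter> T\<close>.\<close>

lemma winner_law:
  assumes Z: "finite Z" and p: "\<And>z. z \<in> Z \<Longrightarrow> p z \<ge> 0" "(\<Sum>z\<in>Z. p z) = 1"
  shows "measure (clocks Z) {\<omega> \<in> space (clocks Z). winner Z p \<omega> \<in> T} = (\<Sum>z\<in>Z \<inter> T. p z)"
proof -
  interpret prob_space "clocks Z" by (rule prob_space_clocks)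
  have in_sets: "{\<omega> \<in> space (clocks Z). winner Z p \<omega> \<in> U} \<in> events" for U
    using measurable_sets[OF measurable_winner[OF Z], of U p]
    by (simp add: vimage_def Int_def conj_commute)
  have on_Z: "prob {\<omega> \<in> space (clocks Z). winner Z p \<omega> \<in> Z \<inter> U} = (\<Sum>z\<in>Z \<inter> U. p z)" for U
  proof -
    have "{\<omega> \<in> space (clocks Z). winner Z p \<omega> \<in> Z \<inter> U} =
      (\<Union>z\<in>Z \<inter> U. {\<omega> \<in> space (clocks Z). winner Z p \<omega> = z})" by auto
    also have "prob \<dots> = (\<Sum>z\<in>Z \<inter> U. prob {\<omega> \<in> space (clocks Z). winner Z p \<omega> = z})"
      using Z sets_winner_eq[OF Z]
      by (intro finite_measure_finite_Union) (auto simp: disjoint_family_on_def)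
    also have "\<dots> = (\<Sum>z\<in>Z \<inter> U. p z)"
      using winner_prob[OF Z p] by (intro sum.cong) auto
    finally show ?thesis .
  qed
  have "AE \<omega> in clocks Z. \<omega> \<in> {\<omega> \<in> space (clocks Z). winner Z p \<omega> \<in> Z \<inter> UNIV}"
    using prob_eq_1[OF in_sets] on_Z[of UNIV] p(2) by simp
  then have "prob {\<omega> \<in> space (clocks Z). winner Z p \<omega> \<in> T} =
      prob {\<omega> \<in> space (clocks Z). winner Z p \<omega> \<in> Z \<inter> T}"
    by (intro finite_measure_eq_AE in_sets) auto
  then show ?thesis by (simp only: on_Z)
qed

section \<open>The simultaneous coupling\<close>

lemma coupling_bound_mono:
  fixes d e :: real
  assumes "0 \<le> d" "d \<le> e"
  shows "2 * d / (1 + d) \<le> 2 * e / (1 + e)"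
  using assms by (simp add: field_simps)

text \<open>At each level \<open>m\<close> all laws race on the same clocks, so the pairwise bound
  holds for all pairs at once. Cylinder marginals are exact for large \<open>m\<close> and the
  disagreement bound is uniform in \<open>m\<close>, so both survive the limit.\<close>

theorem simultaneous_coupling:
  fixes P :: "'s::countable \<Rightarrow> ('x::countable \<Rightarrow> bool) measure"
  assumes P: "\<And>s. prob_space (P s)" "\<And>s. sets (P s) = sets bits"
  obtains L :: "('s \<times> 'x \<Rightarrow> bool) measure" where "prob_space L" "sets L = sets bits"
    "\<And>s. distr L bits (\<lambda>b x. b (s, x)) = P s"
    "\<And>s t. measure L {b. \<exists>x. b (s, x) \<noteq> b (t, x)} \<le> 2 * tv_dist (P s) (P t) / (1 + tv_dist (P s) (P t))"
proof -
  define Z where "Z m = (trunc_range m :: ('x \<Rightarrow> bool) set)" for m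
  define w where "w m s = winner (Z m) (cell_prob m (P s))" for m s
  define joint where "joint m \<omega> = (\<lambda>(s, x). w m s \<omega> x)" for m \<omega>
  have Z: "finite (Z m)" for m by (simp add: Z_def finite_trunc_range)
  have w_law: "measure (clocks (Z m)) {\<omega> \<in> space (clocks (Z m)). w m s \<omega> \<in> T} =
      measure (P s) {h. trunc m h \<in> T}" for m s T
    unfolding w_def winner_law[OF Z cell_prob_nonneg sum_cell_prob_UNIV[OF P, folded Z_def]]
    by (simp add: Z_def sum_cell_prob[OF P])
  have joint: "joint m \<in> measurable (clocks (Z m)) bits" for m
  proof (intro measurable_PiM_single')
    fix i :: "'s \<times> 'x"
    have "(\<lambda>\<omega>. w m (fst i) \<omega> (snd i)) \<in> measurable (clocks (Z m)) (count_space UNIV)"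
      unfolding w_def by (rule measurable_compose[OF measurable_winner[OF Z]]) simp
    then show "(\<lambda>\<omega>. joint m \<omega> i) \<in> measurable (clocks (Z m)) (count_space UNIV)"
      by (simp add: joint_def split_beta)
  qed (simp add: space_PiM)
  define M where "M m = distr (clocks (Z m)) bits (joint m)" for m
  have "prob_space (M m)" for m
    unfolding M_def by (rule prob_space.prob_space_distr[OF prob_space_clocks joint])
  moreover have "sets (M m) = sets bits" for m by (simp add: M_def)
  ultimately obtain \<sigma> L where \<sigma>: "strict_mono \<sigma>" and L: "prob_space L" "sets L = sets bits"
    and lim: "\<And>J F. finite J \<Longrightarrow> depends_on J F \<Longrightarrow>
      (\<lambda>k. measure (M (\<sigma> k)) {b. F b}) \<longlonglongrightarrow> measure L {b. F b}"
    using weakly_convergent_subseq_bits[of M] by blast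
  interpret prob_space L by fact
  have measure_M: "measure (M m) {b. F b} =
      measure (clocks (Z m)) {\<omega> \<in> space (clocks (Z m)). F (\<lambda>(s, x). w m s \<omega> x)}"
    if "finite J" "depends_on J F" for m J F
    unfolding M_def measure_distr[OF joint sets_bits_cylinder[OF that]]
    by (simp add: vimage_def Int_def conj_commute joint_def)
  have sect: "(\<lambda>b x. b (s, x)) \<in> measurable L bits" for s
    unfolding measurable_cong_sets[OF L(2) refl]
    by (intro measurable_PiM_single') (auto simp: space_PiM)
  have marginal: "measure L {b. \<forall>x\<in>J. b (s, x) \<in> B x} = measure (P s) {h. \<forall>x\<in>J. h x \<in> B x}"
    if J: "finite J" for J B s
  proof -
    let ?F = "\<lambda>b :: 's \<times> 'x \<Rightarrow> bool. \<forall>x\<in>J. b (s, x) \<in> B x"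
    have F: "finite ({s} \<times> J)" "depends_on ({s} \<times> J) ?F"
      using J by (auto simp: depends_on_def)
    \<comment> \<open>From level \<open>N\<close> on, truncation leaves the points of
      \<open>J\<close> untouched, so the sequence whose limit is taken is eventually
      constant.\<close>
    obtain N where N: "\<And>x. x \<in> J \<Longrightarrow> to_nat x < N"
      using finite_nat_set_iff_bounded[of "to_nat ` J"] J by auto
    have "measure (M m) {b. ?F b} = measure (P s) {h. \<forall>x\<in>J. h x \<in> B x}" if "m \<ge> N" for m
    proof -
      have "measure (M m) {b. ?F b} = measure (P s) {h. trunc m h \<in> {h. \<forall>x\<in>J. h x \<in> B x}}"
        unfolding measure_M[OF F] using w_law[of m s "{h. \<forall>x\<in>J. h x \<in> B x}"] by simp
      also have "{h. trunc m h \<in> {h. \<forall>x\<in>J. h x \<in> B x}} = {h. \<forall>x\<in>J. h x \<in> B x}"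
        using N that by (fastforce simp: trunc_def)
      finally show ?thesis .
    qed
    moreover have "eventually (\<lambda>k. \<sigma> k \<ge> N) sequentially"
      using filterlim_subseq[OF \<sigma>] by (simp add: filterlim_at_top)
    ultimately have "(\<lambda>k. measure (M (\<sigma> k)) {b. ?F b}) \<longlonglongrightarrow> measure (P s) {h. \<forall>x\<in>J. h x \<in> B x}"
      by (intro tendsto_eventually) (auto elim: eventually_mono)
    with lim[OF F] show ?thesis by (rule LIMSEQ_unique)
  qed
  have "distr L bits (\<lambda>b x. b (s, x)) = P s" for s
  proof (rule measure_eqI_PiM_infinite[of _ UNIV "\<lambda>_. count_space UNIV"])
    show "finite_measure (distr L bits (\<lambda>b x. b (s, x)))"
      by (rule finite_measure_distr[OF sect])
    fix J :: "'x set" and B :: "'x \<Rightarrow> bool set" assume J: "finite J"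
    interpret Ps: prob_space "P s" by (rule P)
    have emb: "prod_emb UNIV (\<lambda>_. count_space UNIV) J (Pi\<^sub>E J B) = {h. \<forall>x\<in>J. h x \<in> B x}"
      by (auto simp: prod_emb_def)
    have "{h. \<forall>x\<in>J. h x \<in> B x} \<in> sets bits"
      by (rule sets_bits_cylinder[OF J]) (auto simp: depends_on_def)
    then have "emeasure (distr L bits (\<lambda>b x. b (s, x))) {h. \<forall>x\<in>J. h x \<in> B x}
        = emeasure L {b. \<forall>x\<in>J. b (s, x) \<in> B x}"
      using sets_eq_imp_space_eq[OF L(2)]
      by (subst emeasure_distr[OF sect]) (simp_all add: vimage_def space_PiM)
    then show "emeasure (distr L bits (\<lambda>b x. b (s, x))) (prod_emb UNIV (\<lambda>_. count_space UNIV) J (Pi\<^sub>E J B))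
        = emeasure (P s) (prod_emb UNIV (\<lambda>_. count_space UNIV) J (Pi\<^sub>E J B))"
      unfolding emb by (simp add: emeasure_eq_measure Ps.emeasure_eq_measure marginal[OF J])
  qed (use P in simp_all)
  moreover have "measure L {b. \<exists>x. b (s, x) \<noteq> b (t, x)}
      \<le> 2 * tv_dist (P s) (P t) / (1 + tv_dist (P s) (P t))" (is "_ \<le> ?bound") for s t
  proof -
    let ?F = "\<lambda>k b. \<exists>x. to_nat x < k \<and> b (s, x :: 'x) \<noteq> b (t, x)"
    let ?J = "\<lambda>k. {s, t} \<times> {x :: 'x. to_nat x < k}"
    have F: "finite (?J k)" "depends_on (?J k) (?F k)" for k :: nat
      using finite_to_nat_less[of k, where ?'x = 'x] by (auto simp: depends_on_def)
    have M_le: "measure (M m) {b. ?F k b} \<le> ?bound" for m k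
    proof -
      interpret C: prob_space "clocks (Z m)" by (rule prob_space_clocks)
      let ?d = "\<Sum>z\<in>Z m. max 0 (cell_prob m (P s) z - cell_prob m (P t) z)"
      have "measure (M m) {b. ?F k b} \<le> C.prob {\<omega> \<in> space (clocks (Z m)). w m s \<omega> \<noteq> w m t \<omega>}"
        unfolding measure_M[OF F] w_def
        by (intro C.finite_measure_mono sets.sets_Collect_neg sets_winners_eq Z) auto
      also have "\<dots> \<le> 2 * ?d / (1 + ?d)"
        unfolding w_def
        by (intro winners_differ_prob Z cell_prob_nonneg refl)
          (simp_all add: Z_def sum_cell_prob_UNIV P)
      also have "\<dots> \<le> ?bound"
        by (intro coupling_bound_mono sum_nonneg)
          (simp_all add: Z_def cell_excess_le_tv_dist P)
      finally show ?thesis .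
    qed
    have le: "measure L {b. ?F k b} \<le> ?bound" for k
      by (rule LIMSEQ_le_const2[OF lim[OF F]]) (use M_le in blast)
    have "(\<lambda>k. measure L {b. ?F k b}) \<longlonglongrightarrow> measure L (\<Union>k. {b. ?F k b})"
    proof (rule finite_Lim_measure_incseq)
      show "range (\<lambda>k. {b. ?F k b}) \<subseteq> sets L"
        using sets_bits_cylinder[OF F] L(2) by auto
      show "incseq (\<lambda>k. {b. ?F k b})"
        by (rule incseq_SucI) (auto intro: less_SucI)
    qed
    then have "measure L (\<Union>k. {b. ?F k b}) \<le> ?bound"
      by (rule LIMSEQ_le_const2) (use le in blast)
    also have "(\<Union>k. {b. ?F k b}) = {b. \<exists>x. b (s, x) \<noteq> b (t, x)}"
      by auto
    finally show ?thesis .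
  qed
  ultimately show thesis using L that by blast
qed

section \<open>From indistinguishability to replicability\<close>

text \<open>The right side is the tangent at \<open>\<rho>\<close> of the concave function on the
  left, and the gap is a square over a positive denominator. Being affine in \<open>d\<close>, it
  commutes with expectation.\<close>

lemma coupling_bound_tangent:
  fixes d \<rho> :: real
  assumes "0 \<le> d" "0 \<le> \<rho>"
  shows "2 * d / (1 + d) \<le> 2 * \<rho> / (1 + \<rho>) + 2 / (1 + \<rho>)\<^sup>2 * (d - \<rho>)"
proof -
  have "2 * \<rho> / (1 + \<rho>) + 2 / (1 + \<rho>)\<^sup>2 * (d - \<rho>) - 2 * d / (1 + d)
      = 2 * (d - \<rho>)\<^sup>2 / ((1 + \<rho>)\<^sup>2 * (1 + d))"
    using assms by (simp add: divide_simps add_nonneg_eq_0_iff) (simp add: algebra_simps power2_eq_square)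
  also have "\<dots> \<ge> 0" using assms by simp
  finally show ?thesis by simp
qed

lemma tv_indistinguishable_integrable:
  fixes A :: "'x::countable sample \<Rightarrow> 'x hypothesis measure"
  assumes "\<And>S. length S = n \<Longrightarrow> prob_space (A S)"
  shows "integrable (pair_pmf (replicate_pmf n D) (replicate_pmf n D)) (\<lambda>(S, S'). tv_dist (A S) (A S'))"
proof (rule measure_pmf.integrable_const_bound[where B = 1])
  show "AE x in pair_pmf (replicate_pmf n D) (replicate_pmf n D).
      norm (case x of (S, S') \<Rightarrow> tv_dist (A S) (A S')) \<le> 1"
    using assms by (auto simp: AE_measure_pmf_iff set_replicate_pmf tv_dist_nonneg tv_dist_le_1)
qed simp

text \<open>Tonelli: for a fixed pair of samples the inner measure is a disagreement probability
  under \<open>R\<close>. Samples in the support have length \<open>n\<close>, so the bound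
  \<open>c\<close> applies almost everywhere.\<close>

lemma disagreement_prob_le:
  fixes f :: "'x::countable sample \<Rightarrow> 'r \<Rightarrow> 'x hypothesis"
  assumes f: "implementation n A R f"
    and c: "\<And>S S'. length S = n \<Longrightarrow> length S' = n \<Longrightarrow> measure R {r \<in> space R. f S r \<noteq> f S' r} \<le> c (S, S')"
    and int: "integrable (pair_pmf (replicate_pmf n D) (replicate_pmf n D)) c"
  shows "disagreement_prob n D R f \<le> measure_pmf.expectation (pair_pmf (replicate_pmf n D) (replicate_pmf n D)) c"
proof -
  interpret R: prob_space R using f by (simp add: implementation_def)
  let ?p = "replicate_pmf n D"
  let ?E = "{(S, S', r). length S = n \<and> length S' = n \<and> r \<in> space R \<and> f S r \<noteq> f S' r}"
  have meas: "?E \<in> sets (?p \<Otimes>\<^sub>M ?p \<Otimes>\<^sub>M R)"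
    by (rule disagreement_event_measurable[OF f])
  interpret pR: pair_prob_space ?p R ..
  have c_nonneg: "AE x in pair_pmf ?p ?p. 0 \<le> c x"
    using c by (auto simp: AE_measure_pmf_iff set_replicate_pmf intro: order.trans[OF measure_nonneg])
  have "emeasure (?p \<Otimes>\<^sub>M ?p \<Otimes>\<^sub>M R) ?E = (\<integral>\<^sup>+ S. emeasure (?p \<Otimes>\<^sub>M R) (Pair S -` ?E) \<partial>?p)"
    by (rule pR.emeasure_pair_measure_alt[OF meas])
  also have "\<dots> = (\<integral>\<^sup>+ S. \<integral>\<^sup>+ S'. emeasure R (Pair S' -` Pair S -` ?E) \<partial>?p \<partial>?p)"
    by (intro nn_integral_cong R.emeasure_pair_measure_alt sets_Pair1[OF meas])
  also have "\<dots> = (\<integral>\<^sup>+ x. emeasure R (Pair (snd x) -` Pair (fst x) -` ?E) \<partial>pair_pmf ?p ?p)"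
    by (simp add: nn_integral_pair_pmf')
  also have "\<dots> \<le> (\<integral>\<^sup>+ x. ennreal (c x) \<partial>pair_pmf ?p ?p)"
  proof (intro nn_integral_mono_AE, unfold AE_measure_pmf_iff, intro ballI)
    fix x assume "x \<in> set_pmf (pair_pmf ?p ?p)"
    then obtain S S' where x: "x = (S, S')" "length S = n" "length S' = n"
      by (auto simp: set_replicate_pmf)
    then have "Pair (snd x) -` Pair (fst x) -` ?E = {r \<in> space R. f S r \<noteq> f S' r}" by auto
    with c[OF x(2,3)] x(1) show "emeasure R (Pair (snd x) -` Pair (fst x) -` ?E) \<le> ennreal (c x)"
      by (simp add: R.emeasure_eq_measure ennreal_leI)
  qed
  also have "\<dots> = ennreal (measure_pmf.expectation (pair_pmf ?p ?p) c)"
    by (rule nn_integral_eq_integral[OF int c_nonneg])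
  finally show ?thesis
    unfolding disagreement_prob_def measure_def
    using integral_nonneg_AE[OF c_nonneg] by (simp add: enn2real_leI)
qed

theorem corollary1:
  fixes A :: "'x::countable sample \<Rightarrow> 'x hypothesis measure" and n :: nat and \<rho> :: real
  assumes "learning_rule n A"
    and "tv_indistinguishable n \<rho> A"
  shows "\<exists>A'. learning_rule n A' \<and> equivalent_rules n A A' \<and> replicable n (2 * \<rho> / (1 + \<rho>)) A'"
proof -
  have A: "prob_space (A S)" "sets (A S) = sets bits" if "length S = n" for S
    using assms(1) that by (auto simp: learning_rule_def space_prob_algebra)
  have tv: "measure_pmf.expectation (pair_pmf (replicate_pmf n D) (replicate_pmf n D))
      (\<lambda>(S, S'). tv_dist (A S) (A S')) \<le> \<rho>" for D
    using assms(2) by (simp add: tv_indistinguishable_def)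
  \<comment> \<open>Gives \<open>\<rho>\<close> its sign, which the tangent bound requires.\<close>
  have "0 \<le> measure_pmf.expectation (pair_pmf (replicate_pmf n D) (replicate_pmf n D))
      (\<lambda>(S, S'). tv_dist (A S) (A S'))" for D :: "('x \<times> bool) pmf"
    by (rule integral_nonneg_AE) (auto simp: AE_measure_pmf_iff set_replicate_pmf tv_dist_nonneg A)
  from order.trans[OF this tv] have \<rho>: "0 \<le> \<rho>" .
  \<comment> \<open>The coupling is indexed by all lists, a countable type; lists of other lengths
    get a point mass as default law.\<close>
  define P where "P S = (if length S = n then A S else return bits (\<lambda>_. False))" for S
  have P: "prob_space (P S)" "sets (P S) = sets bits" for S
    using A by (auto simp: P_def space_PiM intro!: prob_space_return)
  obtain L :: "('x sample \<times> 'x \<Rightarrow> bool) measure" where L: "prob_space L" "sets L = sets bits"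
    and marg: "\<And>S. distr L bits (\<lambda>b x. b (S, x)) = P S"
    and differ: "\<And>S S'. measure L {b. \<exists>x. b (S, x) \<noteq> b (S', x)}
      \<le> 2 * tv_dist (P S) (P S') / (1 + tv_dist (P S) (P S'))"
    using simultaneous_coupling[of P, OF P] by blast
  have space_L: "space L = UNIV"
    using sets_eq_imp_space_eq[OF L(2)] by (simp add: space_PiM)
  \<comment> \<open>Moves the coupling to the sample space \<open>nat \<Rightarrow> real\<close>
    prescribed by \<open>replicable\<close>: bits are renumbered along the countable index set and
    stored as 0 and 1. \<open>f\<close> looks up the bits at the codes of
    \<open>(S, x)\<close>.\<close>
  define enc where "enc b = (\<lambda>k. of_bool (b (from_nat k)) :: real)" for b :: "'x sample \<times> 'x \<Rightarrow> bool"
  define f :: "'x sample \<Rightarrow> (nat \<Rightarrow> real) \<Rightarrow> 'x hypothesis"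
    where "f S r = (\<lambda>x. r (to_nat (S, x)) = 1)" for S r
  have enc: "enc \<in> measurable L (Pi\<^sub>M UNIV (\<lambda>_. borel))"
    unfolding measurable_cong_sets[OF L(2) refl] enc_def
  proof (intro measurable_PiM_single')
    fix k :: nat
    have "(\<lambda>b. b (from_nat k)) \<in> measurable bits (count_space UNIV :: bool measure)"
      by (rule measurable_component_singleton) simp
    then show "(\<lambda>b :: 'x sample \<times> 'x \<Rightarrow> bool. of_bool (b (from_nat k))) \<in> borel_measurable bits"
      by (rule measurable_compose) simp
  qed (simp add: space_PiM)
  define R where "R = distr L (Pi\<^sub>M UNIV (\<lambda>_. borel)) enc"
  have f: "f S \<in> measurable R bits" for S
    unfolding R_def measurable_distr_eq1 f_def
    by (intro measurable_PiM_single') (auto simp: space_PiM)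
  have f_enc: "f S \<circ> enc = (\<lambda>b x. b (S, x))" for S
    by (auto simp: f_def enc_def fun_eq_iff)
  have impl: "implementation n A R f"
    unfolding implementation_def
  proof (intro conjI allI impI f)
    show "prob_space R" unfolding R_def by (rule prob_space.prob_space_distr[OF L(1) enc])
    fix S :: "'x sample" assume "length S = n"
    then show "distr R hyp_algebra (f S) = A S"
      unfolding R_def using distr_distr[OF f[unfolded R_def measurable_distr_eq1] enc, of S]
      by (simp add: f_enc marg P_def)
  qed
  have R_differ: "measure R {r \<in> space R. f S r \<noteq> f S' r}
      \<le> 2 * \<rho> / (1 + \<rho>) + 2 / (1 + \<rho>)\<^sup>2 * (tv_dist (A S) (A S') - \<rho>)"
    if "length S = n" "length S' = n" for S S'
  proof -
    have "{r \<in> space R. f S r \<noteq> f S' r} = (\<Union>x. {r \<in> space R. f S r x \<noteq> f S' r x})"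
      by (auto simp: fun_eq_iff)
    moreover have "{r \<in> space R. f S r x \<noteq> f S' r x} \<in> sets R" for x
    proof -
      have "(\<lambda>r. f T r x) \<in> measurable R (count_space UNIV)" for T
        using measurable_compose[OF f measurable_component_singleton[of x UNIV "\<lambda>_. count_space UNIV"]]
        by simp
      then show ?thesis by measurable
    qed
    ultimately have "{r \<in> space R. f S r \<noteq> f S' r} \<in> sets R"
      by auto
    then have "measure R {r \<in> space R. f S r \<noteq> f S' r} = measure L (enc -` {r \<in> space R. f S r \<noteq> f S' r})"
      using measure_distr[OF enc] by (simp add: R_def space_L)
    also have "enc -` {r \<in> space R. f S r \<noteq> f S' r} = {b. \<exists>x. b (S, x) \<noteq> b (S', x)}"
      by (auto simp: R_def space_PiM f_def enc_def fun_eq_iff)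
    also have "measure L \<dots> \<le> 2 * tv_dist (A S) (A S') / (1 + tv_dist (A S) (A S'))"
      using differ[of S S'] that by (simp add: P_def)
    also have "\<dots> \<le> 2 * \<rho> / (1 + \<rho>) + 2 / (1 + \<rho>)\<^sup>2 * (tv_dist (A S) (A S') - \<rho>)"
      using A that \<rho> by (intro coupling_bound_tangent tv_dist_nonneg) auto
    finally show ?thesis .
  qed
  have "disagreement_prob n D R f \<le> 2 * \<rho> / (1 + \<rho>)" for D :: "('x \<times> bool) pmf"
  proof -
    let ?p = "pair_pmf (replicate_pmf n D) (replicate_pmf n D)"
    let ?d = "\<lambda>(S, S'). tv_dist (A S) (A S')"
    have int: "integrable ?p ?d"
      by (rule tv_indistinguishable_integrable) (rule A)
    txt \<open>Jensen's inequality for the concave bound, by integrating its tangent at \<open>\<rho>\<close>.\<close>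
    have "disagreement_prob n D R f \<le>
        measure_pmf.expectation ?p (\<lambda>x. 2 * \<rho> / (1 + \<rho>) + 2 / (1 + \<rho>)\<^sup>2 * (?d x - \<rho>))"
    proof (rule disagreement_prob_le[OF impl])
      show "integrable ?p (\<lambda>x. 2 * \<rho> / (1 + \<rho>) + 2 / (1 + \<rho>)\<^sup>2 * (?d x - \<rho>))"
        using int by (intro Bochner_Integration.integrable_add integrable_mult_right
          Bochner_Integration.integrable_diff) auto
    qed (use R_differ in auto)
    also have "\<dots> = 2 * \<rho> / (1 + \<rho>) + 2 / (1 + \<rho>)\<^sup>2 * (measure_pmf.expectation ?p ?d - \<rho>)"
      using int by (simp add: integrable_mult_right)
    also have "\<dots> \<le> 2 * \<rho> / (1 + \<rho>)"
      using mult_left_mono[OF tv[of D], of "2 / (1 + \<rho>)\<^sup>2"] by (simp add: algebra_simps)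
    finally show ?thesis .
  qed
  \<comment> \<open>The witness is \<open>A\<close> itself: replicability asks only for some
    implementation with the given output laws.\<close>
  with impl have "replicable n (2 * \<rho> / (1 + \<rho>)) A"
    unfolding replicable_def by blast
  with assms(1) show ?thesis by (auto simp: equivalent_rules_def)
qed

end
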